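(* Let $N\ge 1$ be an integer. For a positive divisor $m$ of $N$ and an integer $n$ (which matters only modulo $m$), let $I(N,m,n)$ be the index of the theory $(\mathrm{SU}(N)/\mathbb{Z}_m)_n$ defined in the context. Then $I$ is invariant under the duality transformations $T$ and $S$: (T-duality) $T$ maps $(\mathrm{SU}(N)/\mathbb{Z}_m)_n$ to $(\mathrm{SU}(N)/\mathbb{Z}_m)_{n+N/m}$, and for every positive divisor $m$ of $N$ and every $n\in\mathbb{Z}$, $$I\left(N,m,n+\tfrac{N}{m}\right)=I(N,m,n).$$ (S-duality) If the theories $(\mathrm{SU}(N)/\mathbb{Z}_m)_n$ and $(\mathrm{SU}(N)/\mathbb{Z}_{m'})_{n'}$ are $S$-dual (in the sense of the context), then $$m'=\frac{N}{\gcd(m,n)},\qquad \gcd(m',n')=\frac{N}{m},$$ and $$I(N,m,n)=I(N,m',n').$$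
   Context: For $N\ge1$, $m\ge 1$ a divisor of $N$ and $n\in\mathbb{Z}$, define $$I(N,m,n)=\frac{N}{m}\sum_{d\mid N}\ \sum_{l=1}^{\gcd(d,m)}\gcd\!\left(\gcd(d,m),\ n+\frac{l\,d}{\gcd(d,m)}\right),$$ where $d$ runs over the positive divisors of $N$, and gcd is non-negative with $\gcd(a,0)=|a|$. This is the number of massive vacua of the $\mathcal{N}=1^\ast$ theory $(\mathrm{SU}(N)/\mathbb{Z}_m)_n$ compactified on a circle. The theory $(\mathrm{SU}(N)/\mathbb{Z}_m)_n$ is the one whose line operators have (electric, magnetic) charges forming the subgroup $L_{m,n}=(m,0)\mathbb{Z}+(n,\tfrac{N}{m})\mathbb{Z}$ of $\mathbb{Z}_N\times\mathbb{Z}_N$ (both entries taken modulo $N$). The theories $(\mathrm{SU}(N)/\mathbb{Z}_m)_n$ and $(\mathrm{SU}(N)/\mathbb{Z}_{m'})_{n'}$, with $m,m'$ positive divisors of $N$ and $n,n'\in\mathbb{Z}$, are called $S$-dual if $L_{m',n'}$ is the image of $L_{m,n}$ under the exchange of electric and magnetic charges $(e,g)\mapsto(-g,e)$; since the subgroups are closed under negation this relation is symmetric and does not depend on the choice of overall sign in the map. *)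

theory Defs
  imports Main
begin

text \<open>Below \<open>m\<close> and \<open>d\<close> divide \<open>N > 0\<close>, so every \<open>div\<close> in this theory is an exact division.\<close>

definition vacua_index :: "nat \<Rightarrow> nat \<Rightarrow> int \<Rightarrow> int" where
  "vacua_index N m n =
     int (N div m) *
       (\<Sum>d\<in>{d. d dvd N}. \<Sum>l=1..gcd d m.
          gcd (int (gcd d m)) (n + int (l * d div gcd d m)))"

text \<open>\<open>\<int>\<^sub>N \<times> \<int>\<^sub>N\<close> is represented by pairs of least non-negative residues modulo \<open>N\<close>;
  the entries are (electric, magnetic).\<close>

definition line_charges :: "nat \<Rightarrow> nat \<Rightarrow> int \<Rightarrow> (int \<times> int) set" where
  "line_charges N m n =
     {((a * int m + b * n) mod int N, (b * int (N div m)) mod int N) | a b. True}"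

definition S_map :: "nat \<Rightarrow> int \<times> int \<Rightarrow> int \<times> int" where
  "S_map N = (\<lambda>(e, g). ((- g) mod int N, e mod int N))"

definition S_dual :: "nat \<Rightarrow> nat \<Rightarrow> int \<Rightarrow> nat \<Rightarrow> int \<Rightarrow> bool" where
  "S_dual N m n m' n' \<longleftrightarrow> line_charges N m' n' = S_map N ` line_charges N m n"

end

(* For m dividing N, the index has the closed form
     N * (\<Sum>r | r dvd gcd (N / m) (gcd m n). totient r * (number of divisors of N / r^2)).
   The theory (SU(N)/Z_m)_n enters only through N / m and gcd m n. T leaves gcd (N / m) (gcd m n)
   unchanged, and S exchanges N / m with gcd m n, because these two numbers generate the
   projections of the charge lattice to the magnetic and to the electric coordinate.

   For the closed form, write N = M m. Divisors d of M m correspond to coprime pairs (e, f) with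
   e dvd M and f dvd m through d = e (m / f). For fixed e, expanding the gcd as a totient sum
   over its divisors turns the sum over f and l into m times the sum of totient (gcd u e) over
   those u dvd m for which gcd u e divides n. Finally the pairs (e, u) are grouped by r = gcd u e;
   by the same correspondence there are as many of them as divisors of (M / r) (m / r). *)

theory Submission
  imports Defs "HOL-Number_Theory.Totient"
begin

section \<open>Periodic conditions and linear congruences\<close>

lemma card_periodic:
  fixes P :: "nat \<Rightarrow> bool"
  assumes periodic: "\<And>x. P (x + q) = P x"
  shows "card {x \<in> {1..k * q}. P x} = k * card {x \<in> {1..q}. P x}"
proof (induction k)
  case 0
  then show ?case by simp
next
  case (Suc k)
  have shift: "P (x + k * q) = P x" for x
    by (induction k) (simp_all add: periodic add.assoc [symmetric] add.commute [of q])
  have "{x \<in> {1..Suc k * q}. P x} =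
      {x \<in> {1..k * q}. P x} \<union> (\<lambda>x. x + k * q) ` {x \<in> {1..q}. P x}" (is "?A = ?B \<union> ?C")
  proof (intro equalityI subsetI)
    fix x assume x: "x \<in> ?A"
    show "x \<in> ?B \<union> ?C"
    proof (cases "x \<le> k * q")
      case False
      then have "x = (x - k * q) + k * q" "x - k * q \<in> {1..q}" using x by auto
      then show ?thesis using x shift by (metis (mono_tags, lifting) UnI2 image_eqI mem_Collect_eq)
    qed (use x in auto)
  qed (auto simp: shift)
  moreover have "?B \<inter> ?C = {}" by auto
  moreover have "card ?C = card {x \<in> {1..q}. P x}"
    by (rule card_image) (simp add: inj_on_def)
  ultimately show ?case
    using Suc.IH by (simp add: card_Un_disjoint)
qed

text \<open>Since \<open>e\<close> is invertible modulo \<open>q\<close>, the condition fixes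
  \<open>l\<close> modulo \<open>q\<close>. Each of the \<open>g div q\<close> blocks of
  \<open>q\<close> consecutive integers therefore contains exactly one solution.\<close>

lemma card_cong_solutions:
  fixes a :: int and e q :: nat
  assumes "coprime q e" "q dvd g" "g > 0"
  shows "card {l \<in> {1..g}. int q dvd a + int (l * e)} = g div q"
proof -
  have q: "q > 0" using assms by (auto intro: Nat.gr0I)
  obtain y :: int where y: "[int e * y = 1] (mod int q)"
    using assms(1) cong_solve_coprime_int [of "int e" "int q"] by (auto simp: coprime_commute)
  define z where "z = - a * y"
  have iff: "int q dvd a + int (l * e) \<longleftrightarrow> [int l = z] (mod int q)" for l
  proof -
    have "int q dvd a + int (l * e) \<longleftrightarrow> [int l * int e = - a] (mod int q)"
      by (simp add: cong_iff_dvd_diff add.commute)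
    also have "\<dots> \<longleftrightarrow> [int l = z] (mod int q)"
    proof
      assume "[int l * int e = - a] (mod int q)"
      then have "[int l * int e * y = z] (mod int q)" unfolding z_def by (rule cong_scalar_right)
      moreover have "[int l * (int e * y) = int l * 1] (mod int q)" by (intro cong_scalar_left y)
      ultimately show "[int l = z] (mod int q)"
        by (metis cong_sym cong_trans mult.assoc mult.right_neutral)
    next
      assume "[int l = z] (mod int q)"
      then have "[int l * int e = z * int e] (mod int q)" by (rule cong_scalar_right)
      moreover have "[- a * (int e * y) = - a * 1] (mod int q)" by (intro cong_scalar_left y)
      ultimately show "[int l * int e = - a] (mod int q)"
        unfolding z_def by (metis cong_trans mult.assoc mult.commute mult.right_neutral)
    qed
    finally show ?thesis .
  qed
  \<comment> \<open>The block starts at 1, so the residue class of 0 is represented by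
    \<open>q\<close>.\<close>
  have "{l \<in> {1..q}. [int l = z] (mod int q)} = {if nat (z mod int q) = 0 then q else nat (z mod int q)}"
  proof -
    have "[int l = z] (mod int q) \<longleftrightarrow> l mod q = nat (z mod int q)" for l
      using q by (auto simp: cong_def zmod_int [symmetric] simp flip: of_nat_mod)
    moreover have "nat (z mod int q) < q" using q by (simp add: nat_less_iff)
    moreover have "l mod q = (if l = q then 0 else l)" if "l \<in> {1..q}" for l using that by auto
    ultimately show ?thesis using q by (auto split: if_splits dest: dvd_imp_le)
  qed
  then have "card {l \<in> {1..q}. int q dvd a + int (l * e)} = 1" unfolding iff by simp
  moreover have "int q dvd a + int ((l + q) * e) \<longleftrightarrow> int q dvd a + int (l * e)" for l
    unfolding iff by (simp add: cong_def)
  ultimately show ?thesis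
    using card_periodic [of "\<lambda>l. int q dvd a + int (l * e)" q "g div q"] assms(2) by simp
qed

section \<open>Totient expansions of gcd sums\<close>

text \<open>Each gcd is expanded as the sum of the totients of its divisors \<open>c\<close>, and
  the two sums are exchanged. What remains is to count the \<open>l\<close> with \<open>c\<close>
  dividing \<open>a + l * e\<close>: there are none unless \<open>gcd c e\<close> divides
  \<open>a\<close>, and otherwise cancelling \<open>gcd c e\<close> leaves a congruence with
  invertible coefficient modulo \<open>c div gcd c e\<close>.\<close>

lemma sum_gcd_arith_progression:
  fixes a :: int and e g :: nat
  assumes "g > 0"
  shows "(\<Sum>l=1..g. gcd (int g) (a + int (l * e))) =
    (\<Sum>c | c dvd g. int (totient c) *
      (if int (gcd c e) dvd a then int (g div c * gcd c e) else 0))"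
proof -
  have count: "int (card {l \<in> {1..g}. int c dvd a + int (l * e)}) =
      (if int (gcd c e) dvd a then int (g div c * gcd c e) else 0)" if c: "c dvd g" for c
  proof (cases "int (gcd c e) dvd a")
    case True
    define h where "h = gcd c e"
    have c0: "c > 0" using c assms by (auto intro: Nat.gr0I)
    then have h0: "h > 0" by (simp add: h_def)
    obtain q e' where qe: "c = q * h" "e = e' * h" "coprime q e'"
      using gcd_coprime_exists [of c e] h0 unfolding h_def by auto
    obtain b where b: "a = int h * b" using True by (auto simp: h_def)
    have "int c dvd a + int (l * e) \<longleftrightarrow> int q dvd b + int (l * e')" for l
    proof -
      have "a + int (l * e) = int h * (b + int (l * e'))" by (simp add: b qe algebra_simps)
      then show ?thesis using h0 by (simp add: qe mult.commute)
    qed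
    then have "card {l \<in> {1..g}. int c dvd a + int (l * e)} = g div q"
      using card_cong_solutions [of q e' g b] qe c assms by (auto dest: dvd_mult_left)
    moreover have "g div q = g div c * h"
      using c c0 by (auto simp: qe elim!: dvdE)
    ultimately show ?thesis using True by (simp add: h_def)
  next
    case False
    have "\<not> int c dvd a + int (l * e)" for l
    proof
      assume "int c dvd a + int (l * e)"
      then have "int (gcd c e) dvd a + int (l * e)"
        by (meson dvd_trans gcd_dvd1 of_nat_dvd_iff)
      moreover have "int (gcd c e) dvd int (l * e)" by (metis dvd_mult gcd_dvd2 of_nat_dvd_iff)
      ultimately show False using False by (simp add: dvd_add_left_iff)
    qed
    then show ?thesis using False by simp
  qed
  have fin: "finite {c. c dvd g}" using assms by simp
  have gcd_totient: "gcd (int g) x = (\<Sum>c | c dvd g. if int c dvd x then int (totient c) else 0)" for x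
  proof -
    have "gcd (int g) x = int (gcd g (nat \<bar>x\<bar>))" unfolding gcd_int_def by (simp only: abs_of_nat nat_int)
    also have "\<dots> = (\<Sum>c | c dvd gcd g (nat \<bar>x\<bar>). int (totient c))"
      by (simp flip: of_nat_sum add: totient_divisor_sum)
    also have "\<dots> = (\<Sum>c | c dvd g \<and> int c dvd x. int (totient c))"
      by (intro sum.cong) (simp_all only: gcd_greatest_iff dvd_nat_abs_iff)
    also have "\<dots> = (\<Sum>c | c dvd g. if int c dvd x then int (totient c) else 0)"
      using fin by (simp add: sum.If_cases Int_def)
    finally show ?thesis .
  qed
  have "(\<Sum>l=1..g. gcd (int g) (a + int (l * e))) =
      (\<Sum>c | c dvd g. \<Sum>l=1..g. if int c dvd a + int (l * e) then int (totient c) else 0)"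
    unfolding gcd_totient by (rule sum.swap)
  also have "\<dots> = (\<Sum>c | c dvd g. int (totient c) * int (card {l \<in> {1..g}. int c dvd a + int (l * e)}))"
    by (simp add: sum.If_cases Int_def mult.commute)
  also have "\<dots> = (\<Sum>c | c dvd g. int (totient c) *
      (if int (gcd c e) dvd a then int (g div c * gcd c e) else 0))"
    by (intro sum.cong refl) (simp only: count mem_Collect_eq)
  finally show ?thesis .
qed

lemma sum_totient_coprime_codivisor:
  fixes u e :: nat
  assumes u: "u > 0"
  shows "gcd u e * (\<Sum>c | c dvd u \<and> coprime (u div c) e. totient c) = u * totient (gcd u e)"
proof -
  define G where "G = gcd u e"
  have G: "G > 0" "G dvd u" using u by (auto simp: G_def)
  define C where "C = {c. c dvd u \<and> coprime (u div c) e}"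
  \<comment> \<open>Since \<open>card (A c) = totient c\<close>, both sides count the \<open>j \<le> u\<close> coprime to \<open>G\<close>, up to the factor \<open>G\<close>.\<close>
  define A where "A = (\<lambda>c. {j \<in> {1..u}. gcd j u = u div c})"
  have finC: "finite C" using u by (simp add: C_def)
  have codivisor: "u div c dvd u" "u div (u div c) = c" "u div c > 0" if "c dvd u" for c
    using that u by (auto elim!: dvdE)
  have cardA: "card (A c) = totient c" if "c dvd u" for c
  proof -
    have "card {k \<in> {0<..u}. gcd k u = u div c} = totient c"
      using card_gcd_eq_totient [of u "u div c"] codivisor [OF that] u by simp
    then show ?thesis by (simp add: A_def atLeastSucAtMost_greaterThanAtMost)
  qed
  \<comment> \<open>Membership of \<open>c\<close> in \<open>C\<close> is a condition on
    \<open>u div c\<close>, which equals \<open>gcd j u\<close> on \<open>A c\<close>. Associativity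
    of gcd turns it into a condition on \<open>j\<close> alone, so the classes \<open>A c\<close>
    with \<open>c\<close> in \<open>C\<close> fill up exactly the \<open>j\<close> coprime to
    \<open>G\<close>.\<close>
  have coprime_iff: "coprime (gcd j u) e \<longleftrightarrow> coprime j G" for j
    by (simp add: G_def coprime_iff_gcd_eq_1 gcd.assoc)
  have "(\<Union>c\<in>C. A c) = {j \<in> {1..u}. coprime j G}" (is "?L = ?R")
  proof (intro equalityI subsetI)
    fix j assume j: "j \<in> ?R"
    have "u div (u div gcd j u) = gcd j u" "u div gcd j u dvd u"
      using u codivisor [of "gcd j u"] by auto
    then have "u div gcd j u \<in> C" "j \<in> A (u div gcd j u)"
      using j coprime_iff by (auto simp: C_def A_def)
    then show "j \<in> ?L" by blast
  next
    fix j assume "j \<in> ?L"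
    then obtain c where "c \<in> C" and j: "j \<in> {1..u}" "gcd j u = u div c" by (auto simp: A_def)
    then have "coprime (gcd j u) e" by (simp add: C_def)
    then show "j \<in> ?R" using j(1) coprime_iff by simp
  qed
  moreover have "card (\<Union>c\<in>C. A c) = (\<Sum>c\<in>C. card (A c))"
  proof (rule card_UN_disjoint [OF finC])
    show "\<forall>c\<in>C. finite (A c)" by (simp add: A_def)
    show "\<forall>c\<in>C. \<forall>c'\<in>C. c \<noteq> c' \<longrightarrow> A c \<inter> A c' = {}"
    proof (intro ballI impI)
      fix c c' assume "c \<in> C" "c' \<in> C" "c \<noteq> c'"
      then have "u div c \<noteq> u div c'" using codivisor(2) unfolding C_def by (metis mem_Collect_eq)
      then show "A c \<inter> A c' = {}" by (auto simp: A_def)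
    qed
  qed
  moreover have "(\<Sum>c\<in>C. card (A c)) = (\<Sum>c\<in>C. totient c)"
    by (intro sum.cong) (auto simp: C_def cardA)
  moreover have "card {j \<in> {1..u}. coprime j G} = u div G * totient G"
  proof -
    have "{j \<in> {1..G}. coprime j G} = totatives G" by (auto simp: totatives_def)
    moreover have "coprime (j + G) G = coprime j G" for j
      by (simp add: coprime_iff_gcd_eq_1)
    ultimately show ?thesis
      using card_periodic [of "\<lambda>j. coprime j G" G "u div G"] G by (simp add: totient_def)
  qed
  ultimately have "(\<Sum>c\<in>C. totient c) = u div G * totient G" by simp
  then show ?thesis using G unfolding C_def G_def by simp
qed

section \<open>Divisors of a product and coprime pairs\<close>

text \<open>The pair \<open>(e, f)\<close> is the fraction \<open>d / m\<close> in lowest terms, so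
  \<open>gcd d m = m div f\<close> and \<open>d = e * (m div f)\<close>. Cancelling
  \<open>gcd d m\<close> turns \<open>d dvd M * m\<close> into \<open>e dvd M * f\<close>, which by
  coprimality means \<open>e dvd M\<close>.\<close>

lemma sum_divisors_of_product:
  fixes m M :: nat and F :: "nat \<Rightarrow> nat \<Rightarrow> 'a::comm_monoid_add"
  assumes "m > 0" "M > 0"
  shows "(\<Sum>d | d dvd M * m. F (gcd d m) (d div gcd d m)) =
    (\<Sum>e | e dvd M. \<Sum>f | f dvd m \<and> coprime f e. F (m div f) e)"
proof -
  have "(\<Sum>d | d dvd M * m. F (gcd d m) (d div gcd d m)) =
      (\<Sum>(e, f)\<in>(SIGMA e:{e. e dvd M}. {f. f dvd m \<and> coprime f e}). F (m div f) e)"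
  proof (rule sum.reindex_bij_witness
      [where i = "\<lambda>(e, f). e * (m div f)" and j = "\<lambda>d. (d div gcd d m, m div gcd d m)"])
    fix d assume d: "d \<in> {d. d dvd M * m}"
    define g where "g = gcd d m"
    have g: "g > 0" "g dvd m" "g dvd d" using assms by (auto simp: g_def)
    have cop: "coprime (d div g) (m div g)" using assms unfolding g_def by (intro div_gcd_coprime) auto
    have mg: "m div (m div g) = g" using g assms by (auto elim!: dvdE)
    show "(case (d div gcd d m, m div gcd d m) of (e, f) \<Rightarrow> e * (m div f)) = d"
      using g mg by (simp flip: g_def)
    have "d div g dvd M * (m div g)" using d g by (simp add: div_dvd_iff_mult mult.assoc)
    then have "d div g dvd M" using cop by (simp add: coprime_dvd_mult_left_iff)
    moreover have "m div g dvd m" using g by (metis dvd_div_mult_self dvd_triv_left)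
    ultimately show "(d div gcd d m, m div gcd d m) \<in> (SIGMA e:{e. e dvd M}. {f. f dvd m \<and> coprime f e})"
      using cop by (simp flip: g_def add: coprime_commute)
    show "(case (d div gcd d m, m div gcd d m) of (e, f) \<Rightarrow> F (m div f) e) =
        F (gcd d m) (d div gcd d m)"
      using mg by (simp flip: g_def)
  next
    fix ef assume "ef \<in> (SIGMA e:{e. e dvd M}. {f. f dvd m \<and> coprime f e})"
    then obtain e f where ef: "ef = (e, f)" "e dvd M" "f dvd m" "coprime f e" by auto
    obtain k where k: "m = f * k" using ef by auto
    have pos: "f > 0" "k > 0" using k assms by auto
    have "gcd (e * k) m = k"
      using ef(4) by (metis coprime_commute coprime_iff_gcd_eq_1 gcd_mult_distrib_nat k mult.commute mult.right_neutral)
    then show "(\<lambda>d. (d div gcd d m, m div gcd d m)) (case ef of (e, f) \<Rightarrow> e * (m div f)) = ef"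
      using pos by (simp add: ef k)
    show "(case ef of (e, f) \<Rightarrow> e * (m div f)) \<in> {d. d dvd M * m}"
      using ef pos by (simp add: k mult_dvd_mono)
  qed
  also have "\<dots> = (\<Sum>e | e dvd M. \<Sum>f | f dvd m \<and> coprime f e. F (m div f) e)"
    using assms by (intro sum.Sigma [symmetric]) auto
  finally show ?thesis .
qed

text \<open>Dividing both entries by \<open>r\<close> yields the coprime pairs of divisors of
  \<open>M div r\<close> and \<open>m div r\<close>. These are counted by
  \<open>sum_divisors_of_product\<close> with the constant summand 1.\<close>

lemma card_divisor_pairs_gcd_eq:
  fixes m M r :: nat
  assumes "m > 0" "M > 0" "r dvd M" "r dvd m"
  shows "card {(e, u). e dvd M \<and> u dvd m \<and> gcd u e = r} = card {d. d dvd M div r * (m div r)}"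
proof -
  obtain M' m' where M': "M = r * M'" and m': "m = r * m'" using assms by (auto elim!: dvdE)
  have pos: "r > 0" "M' > 0" "m' > 0" using assms M' m' by auto
  have "bij_betw (\<lambda>(e, f). (r * e, r * f)) (SIGMA e:{e. e dvd M'}. {f. f dvd m' \<and> coprime f e})
      {(e, u). e dvd M \<and> u dvd m \<and> gcd u e = r}"
  proof (rule bij_betw_byWitness [where f' = "\<lambda>(e, u). (e div r, u div r)"])
    show "(\<lambda>(e, u). (e div r, u div r)) ` {(e, u). e dvd M \<and> u dvd m \<and> gcd u e = r} \<subseteq>
        (SIGMA e:{e. e dvd M'}. {f. f dvd m' \<and> coprime f e})"
    proof (rule image_subsetI)
      fix p assume "p \<in> {(e, u). e dvd M \<and> u dvd m \<and> gcd u e = r}"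
      then obtain e u where p: "p = (e, u)" and eu: "e dvd M" "u dvd m" "gcd u e = r" by auto
      from eu(3) obtain e' u' where e': "e = r * e'" and u': "u = r * u'"
        by (metis dvdE gcd_dvd1 gcd_dvd2)
      have "r * gcd u' e' = r * 1" using eu(3) by (simp add: e' u' gcd_mult_distrib_nat)
      then have "coprime u' e'" using pos(1) by (simp add: coprime_iff_gcd_eq_1)
      then show "(\<lambda>(e, u). (e div r, u div r)) p \<in> (SIGMA e:{e. e dvd M'}. {f. f dvd m' \<and> coprime f e})"
        using eu(1,2) pos(1) by (simp add: p e' u' M' m')
    qed
  next
    show "(\<lambda>(e, f). (r * e, r * f)) ` (SIGMA e:{e. e dvd M'}. {f. f dvd m' \<and> coprime f e}) \<subseteq>
        {(e, u). e dvd M \<and> u dvd m \<and> gcd u e = r}"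
      by (auto simp: M' m' coprime_iff_gcd_eq_1 simp flip: gcd_mult_distrib_nat)
  qed (use pos in auto)
  then have "card {(e, u). e dvd M \<and> u dvd m \<and> gcd u e = r} =
      card (SIGMA e:{e. e dvd M'}. {f. f dvd m' \<and> coprime f e})"
    by (simp add: bij_betw_same_card)
  also have "\<dots> = (\<Sum>e | e dvd M'. \<Sum>f | f dvd m' \<and> coprime f e. 1)"
    using pos by (subst card_SigmaI) auto
  also have "\<dots> = card {d. d dvd M' * m'}"
    using sum_divisors_of_product [of m' M' "\<lambda>_ _. 1::nat"] pos by simp
  finally show ?thesis using pos by (simp add: M' m')
qed

text \<open>Grouping the pairs by \<open>r = gcd u e\<close> leaves a dependence on \<open>M\<close>
  and \<open>m\<close> only through their product and their gcd. This is the source of the symmetry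
  needed for S-duality.\<close>

lemma sum_gcd_of_divisors:
  fixes m M :: nat and h :: "nat \<Rightarrow> int"
  assumes "m > 0" "M > 0"
  shows "(\<Sum>e | e dvd M. \<Sum>u | u dvd m. h (gcd u e)) =
    (\<Sum>r | r dvd gcd M m. h r * int (card {d. d dvd M * m div (r * r)}))"
proof -
  define S where "S = {e. e dvd M} \<times> {u. u dvd m}"
  define R where "R = {r. r dvd gcd M m}"
  define G where "G = (\<lambda>(e, u). gcd u e :: nat)"
  have "(\<Sum>e | e dvd M. \<Sum>u | u dvd m. h (gcd u e)) = (\<Sum>p\<in>S. h (G p))"
    using assms by (simp add: S_def G_def sum.cartesian_product case_prod_unfold)
  also have "\<dots> = (\<Sum>r\<in>R. \<Sum>p | p \<in> S \<and> G p = r. h (G p))"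
  proof (rule sum.group [symmetric])
    show "finite S" "finite R" using assms by (auto simp: S_def R_def)
    show "G ` S \<subseteq> R" by (auto simp: S_def R_def G_def intro: dvd_trans)
  qed
  also have "\<dots> = (\<Sum>r\<in>R. h r * int (card {d. d dvd M * m div (r * r)}))"
  proof (rule sum.cong [OF refl])
    fix r assume "r \<in> R"
    then have r: "r dvd M" "r dvd m" by (auto simp: R_def)
    have "{p. p \<in> S \<and> G p = r} = {(e, u). e dvd M \<and> u dvd m \<and> gcd u e = r}"
      by (auto simp: S_def G_def)
    moreover have "M div r * (m div r) = M * m div (r * r)"
      using r by (simp add: div_mult_div_if_dvd)
    ultimately have "card {p. p \<in> S \<and> G p = r} = card {d. d dvd M * m div (r * r)}"
      using card_divisor_pairs_gcd_eq [OF assms r] by simp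
    moreover have "(\<Sum>p | p \<in> S \<and> G p = r. h (G p)) = (\<Sum>p | p \<in> S \<and> G p = r. h r)"
      by (rule sum.cong) auto
    ultimately show "(\<Sum>p | p \<in> S \<and> G p = r. h (G p)) = h r * int (card {d. d dvd M * m div (r * r)})"
      by simp
  qed
  finally show ?thesis by (simp add: R_def)
qed

section \<open>Closed form of the index\<close>

text \<open>After the totient expansion, a term depends on \<open>f\<close> and \<open>c\<close>
  only through \<open>totient c\<close> and \<open>u = f * c\<close>, because
  \<open>gcd (f * c) e = gcd c e\<close> when \<open>f\<close> is coprime to \<open>e\<close>.
  Regrouping by \<open>u\<close> leaves the totient sum over the \<open>c\<close> dividing
  \<open>u\<close> with \<open>u div c\<close> coprime to \<open>e\<close>, which
  \<open>sum_totient_coprime_codivisor\<close> evaluates.\<close>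

lemma sum_coprime_divisors_sum_gcd:
  fixes m e :: nat and n :: int
  assumes m: "m > 0"
  shows "(\<Sum>f | f dvd m \<and> coprime f e. \<Sum>l=1..m div f. gcd (int (m div f)) (n + int (l * e))) =
    int m * (\<Sum>u | u dvd m. if int (gcd u e) dvd n then int (totient (gcd u e)) else 0)"
    (is "?lhs = _")
proof -
  define w where "w = (\<lambda>u. if int (gcd u e) dvd n then int (m div u * gcd u e) else 0)"
  have "?lhs = (\<Sum>f | f dvd m \<and> coprime f e. \<Sum>c | c dvd m div f. int (totient c) * w (f * c))"
  proof (rule sum.cong [OF refl])
    fix f assume f: "f \<in> {f. f dvd m \<and> coprime f e}"
    then have "m div f > 0" using m by (auto elim!: dvdE)
    moreover have "gcd (f * c) e = gcd c e" for c
      using f by (simp add: gcd_mult_left_left_cancel coprime_commute)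
    ultimately show "(\<Sum>l=1..m div f. gcd (int (m div f)) (n + int (l * e))) =
        (\<Sum>c | c dvd m div f. int (totient c) * w (f * c))"
      by (subst sum_gcd_arith_progression) (simp_all add: w_def div_mult2_eq del: of_nat_mult cong: if_cong)
  qed
  also have "\<dots> = (\<Sum>(f, c)\<in>(SIGMA f:{f. f dvd m \<and> coprime f e}. {c. c dvd m div f}).
      int (totient c) * w (f * c))"
    using m by (intro sum.Sigma) (auto elim!: dvdE)
  also have "\<dots> = (\<Sum>(u, c)\<in>(SIGMA u:{u. u dvd m}. {c. c dvd u \<and> coprime (u div c) e}).
      int (totient c) * w u)"
  proof (rule sum.reindex_bij_witness
      [where i = "\<lambda>(u, c). (u div c, c)" and j = "\<lambda>(f, c). (f * c, c)"])
    fix p assume "p \<in> (SIGMA f:{f. f dvd m \<and> coprime f e}. {c. c dvd m div f})"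
    then obtain f c where p: "p = (f, c)" "f dvd m" "coprime f e" "c dvd m div f" by auto
    then have "c > 0" "f * c dvd m" using m
      by (auto simp: dvd_div_iff_mult mult.commute intro!: Nat.gr0I)
    then show "(\<lambda>(u, c). (u div c, c)) (case p of (f, c) \<Rightarrow> (f * c, c)) = p"
      "(case p of (f, c) \<Rightarrow> (f * c, c)) \<in>
        (SIGMA u:{u. u dvd m}. {c. c dvd u \<and> coprime (u div c) e})"
      "(case case p of (f, c) \<Rightarrow> (f * c, c) of (u, c) \<Rightarrow> int (totient c) * w u) =
        (case p of (f, c) \<Rightarrow> int (totient c) * w (f * c))"
      using p by simp_all
  next
    fix p assume "p \<in> (SIGMA u:{u. u dvd m}. {c. c dvd u \<and> coprime (u div c) e})"
    then obtain u c where p: "p = (u, c)" "u dvd m" "c dvd u" "coprime (u div c) e" by auto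
    from p(3) obtain f where f: "u = f * c" by (metis dvdE mult.commute)
    have "c > 0" "f > 0" using p(2) f m by (auto intro!: Nat.gr0I)
    then show "(\<lambda>(f, c). (f * c, c)) (case p of (u, c) \<Rightarrow> (u div c, c)) = p"
      "(case p of (u, c) \<Rightarrow> (u div c, c)) \<in>
        (SIGMA f:{f. f dvd m \<and> coprime f e}. {c. c dvd m div f})"
      using p f by (auto simp: dvd_div_iff_mult mult.commute dest: dvd_mult_left)
  qed
  also have "\<dots> = (\<Sum>u | u dvd m. \<Sum>c | c dvd u \<and> coprime (u div c) e. int (totient c) * w u)"
    using m by (intro sum.Sigma [symmetric]) (auto simp: dvd_pos_nat)
  also have "\<dots> = (\<Sum>u | u dvd m. int m * (if int (gcd u e) dvd n then int (totient (gcd u e)) else 0))"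
  proof (rule sum.cong [OF refl])
    fix u assume "u \<in> {u. u dvd m}"
    then have u: "u dvd m" "u > 0" using m by (auto simp: dvd_pos_nat)
    define s where "s = (\<Sum>c | c dvd u \<and> coprime (u div c) e. totient c)"
    \<comment> \<open>The factor \<open>gcd u e\<close> contributed by \<open>w u\<close> is the one
      that makes the totient sum evaluate; the \<open>u\<close> it produces then cancels against
      \<open>m div u\<close>.\<close>
    have "m div u * gcd u e * s = m div u * (u * totient (gcd u e))"
      using sum_totient_coprime_codivisor [OF u(2), of e] by (simp add: s_def mult.assoc)
    also have "\<dots> = m * totient (gcd u e)" using u by (simp flip: mult.assoc)
    finally have "int s * int (m div u * gcd u e) = int m * int (totient (gcd u e))"
      by (metis mult.commute of_nat_mult)
    moreover have "(\<Sum>c | c dvd u \<and> coprime (u div c) e. int (totient c) * w u) = int s * w u"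
      by (simp add: s_def sum_distrib_right)
    ultimately show "(\<Sum>c | c dvd u \<and> coprime (u div c) e. int (totient c) * w u) =
        int m * (if int (gcd u e) dvd n then int (totient (gcd u e)) else 0)"
      by (simp add: w_def)
  qed
  finally show ?thesis by (simp add: sum_distrib_left)
qed

lemma vacua_index_eq:
  assumes N: "N > 0" and m: "m dvd N"
  shows "vacua_index N m n = int N *
    (\<Sum>r | int r dvd gcd (int (N div m)) (gcd (int m) n).
      int (totient r) * int (card {d. d dvd N div (r * r)}))"
proof -
  define M where "M = N div m"
  have NM: "N = M * m" using m by (simp add: M_def)
  have pos: "M > 0" "m > 0" using N NM by auto
  define h where "h = (\<lambda>r. if int r dvd n then int (totient r) else 0)"
  \<comment> \<open>The inner sum over \<open>l\<close> depends on \<open>d\<close> only through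
    \<open>gcd d m\<close> and \<open>d div gcd d m\<close>, which is the shape that
    \<open>sum_divisors_of_product\<close> handles.\<close>
  define \<Phi> where "\<Phi> = (\<lambda>g e. \<Sum>l=1..g. gcd (int g) (n + int (l * e)))"
  have "vacua_index N m n = int M * (\<Sum>d | d dvd M * m. \<Phi> (gcd d m) (d div gcd d m))"
    by (simp add: vacua_index_def M_def [symmetric] NM [symmetric] \<Phi>_def div_mult_swap
        del: of_nat_mult)
  also have "\<dots> = int M * (\<Sum>e | e dvd M. \<Sum>f | f dvd m \<and> coprime f e. \<Phi> (m div f) e)"
    by (simp add: sum_divisors_of_product pos)
  \<comment> \<open>The factor \<open>m\<close> from the inner sums completes the prefactor
    \<open>M = N div m\<close> to \<open>N\<close>.\<close>
  also have "\<dots> = int N * (\<Sum>e | e dvd M. \<Sum>u | u dvd m. h (gcd u e))"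
    unfolding \<Phi>_def sum_coprime_divisors_sum_gcd [OF pos(2)] h_def
    by (simp add: NM mult.assoc flip: sum_distrib_left)
  also have "\<dots> = int N * (\<Sum>r | r dvd gcd M m. h r * int (card {d. d dvd N div (r * r)}))"
    by (simp add: sum_gcd_of_divisors pos NM)
  \<comment> \<open>The function \<open>h\<close> vanishes at every \<open>r\<close> not dividing
    \<open>n\<close>, so this condition moves into the range of summation.\<close>
  also have "(\<Sum>r | r dvd gcd M m. h r * int (card {d. d dvd N div (r * r)})) =
      (\<Sum>r | int r dvd gcd (int M) (gcd (int m) n).
        int (totient r) * int (card {d. d dvd N div (r * r)}))"
    using pos by (intro sum.mono_neutral_cong_right) (auto simp: h_def)
  finally show ?thesis by (simp add: M_def)
qed

section \<open>Electric and magnetic projections of the charge lattice\<close>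

text \<open>Reduction modulo \<open>N\<close> preserves divisibility by a divisor \<open>D\<close>
  of \<open>N\<close>, so it suffices to test the generators \<open>(m, 0)\<close> and
  \<open>(n, N div m)\<close>. Through such \<open>D\<close> the generator of the electric
  projection can be recovered from the set of charges alone.\<close>

lemma dvd_fst_line_charges_iff:
  assumes "D dvd int N"
  shows "(\<forall>v \<in> line_charges N m n. D dvd fst v) \<longleftrightarrow> D dvd gcd (int m) n"
proof
  assume *: "\<forall>v \<in> line_charges N m n. D dvd fst v"
  have **: "D dvd a * int m + b * n" for a b
    using * assms by (fastforce simp: line_charges_def dvd_mod_iff)
  show "D dvd gcd (int m) n"
    using ** [of 1 0] ** [of 0 1] by simp
qed (use assms in \<open>auto simp: line_charges_def dvd_mod_iff\<close>)

lemma dvd_snd_line_charges_iff: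
  assumes "D dvd int N"
  shows "(\<forall>v \<in> line_charges N m n. D dvd snd v) \<longleftrightarrow> D dvd int (N div m)"
proof
  assume *: "\<forall>v \<in> line_charges N m n. D dvd snd v"
  have "D dvd b * int (N div m)" for b
    using * assms by (fastforce simp: line_charges_def dvd_mod_iff)
  from this [of 1] show "D dvd int (N div m)" by simp
qed (use assms in \<open>auto simp: line_charges_def dvd_mod_iff\<close>)

text \<open>The map S exchanges the two coordinates up to sign, so the divisors of \<open>N\<close>
  dividing all magnetic charges of one theory are those dividing all electric charges of the other.
  The numbers to be compared divide \<open>N\<close> themselves; taking each as \<open>D\<close>
  shows that they divide each other.\<close>

lemma S_dual_gcd:
  assumes N: "N > 0" and m: "m dvd N" and m': "m' dvd N" and dual: "S_dual N m n m' n'"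
  shows "int (N div m') = gcd (int m) n" and "gcd (int m') n' = int (N div m)"
proof -
  have L: "line_charges N m' n' = S_map N ` line_charges N m n"
    using dual by (simp add: S_dual_def)
  have dvd_N: "int (N div k) dvd int N" "gcd (int k) x dvd int N" if "k dvd N" for k x
    using that by (auto intro: dvd_trans [OF gcd_dvd1])
  have snd_iff: "D dvd int (N div m') \<longleftrightarrow> D dvd gcd (int m) n" if D: "D dvd int N" for D
    using dvd_snd_line_charges_iff [OF D, of m' n'] dvd_fst_line_charges_iff [OF D, of m n] D
    unfolding L by (simp add: S_map_def case_prod_unfold dvd_mod_iff)
  have fst_iff: "D dvd gcd (int m') n' \<longleftrightarrow> D dvd int (N div m)" if D: "D dvd int N" for D
    using dvd_fst_line_charges_iff [OF D, of m' n'] dvd_snd_line_charges_iff [OF D, of m n] D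
    unfolding L by (simp add: S_map_def case_prod_unfold dvd_mod_iff)
  show "int (N div m') = gcd (int m) n"
    using snd_iff [OF dvd_N(1) [OF m']] snd_iff [OF dvd_N(2) [OF m, of n]]
    by (intro zdvd_antisym_nonneg) (simp_all only: dvd_refl of_nat_0_le_iff gcd_ge_0_int)
  show "gcd (int m') n' = int (N div m)"
    using fst_iff [OF dvd_N(1) [OF m]] fst_iff [OF dvd_N(2) [OF m', of n']]
    by (intro zdvd_antisym_nonneg) (simp_all only: dvd_refl of_nat_0_le_iff gcd_ge_0_int)
qed

section \<open>Invariance under T and S\<close>

theorem mainTheorem2:
  fixes N :: nat
  assumes "N \<ge> 1"
  shows
    "(\<forall>m n. m dvd N \<longrightarrow> vacua_index N m (n + int (N div m)) = vacua_index N m n) \<and>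
     (\<forall>m n m' n'. m dvd N \<longrightarrow> m' dvd N \<longrightarrow> S_dual N m n m' n' \<longrightarrow>
        int m' = int N div gcd (int m) n \<and>
        gcd (int m') n' = int (N div m) \<and>
        vacua_index N m n = vacua_index N m' n')"
proof (intro conjI allI impI)
  have N: "N > 0" using assms by simp
  fix m n assume m: "m dvd N"
  \<comment> \<open>Any \<open>r\<close> in question already divides the shift
    \<open>N div m\<close>.\<close>
  have "int r dvd gcd (int (N div m)) (gcd (int m) (n + int (N div m))) \<longleftrightarrow>
      int r dvd gcd (int (N div m)) (gcd (int m) n)" for r
    by (auto simp: dvd_add_left_iff)
  then show "vacua_index N m (n + int (N div m)) = vacua_index N m n"
    by (simp only: vacua_index_eq [OF N m])
next
  have N: "N > 0" using assms by simp
  fix m n m' n' assume m: "m dvd N" and m': "m' dvd N" and dual: "S_dual N m n m' n'"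
  note gcds = S_dual_gcd [OF N m m' dual]
  show "gcd (int m') n' = int (N div m)" by (rule gcds)
  have "N div (N div m') = m'" using m' N by (auto elim!: dvdE)
  then show "int m' = int N div gcd (int m) n"
    by (simp flip: gcds(1) zdiv_int)
  \<comment> \<open>By \<open>gcds\<close> both closed forms involve the same two numbers, in
    opposite order inside a gcd.\<close>
  show "vacua_index N m n = vacua_index N m' n'"
    unfolding vacua_index_eq [OF N m] vacua_index_eq [OF N m'] gcds by (simp add: gcd.commute)
qed

end
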